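(* Let $P,Q\in\mathbb{Z}$ with $PQ\neq 0$, let $p\geq 3$ be a prime dividing both $P$ and $Q$, and write $P=p^aP'$, $Q=p^bQ'$ with $a,b\geq 1$ and $p\nmid P'Q'$. Suppose $b=2a$ and let $r\geq 1$ be an integer. Then \[ \mathcal{L}(P,Q,p^{-r})=S_{\lceil (r+a)/a\rceil}\cup\Big\{n\in\langle\rho'\rangle : \nu_p\big(\tfrac{n}{\rho'}\big)\geq r+a-an-\nu'\Big\}. \] Moreover, if $\rho'\geq\lceil (r+a)/a\rceil$, then $\mathcal{L}(P,Q,p^{-r})=S_{\lceil (r+a)/a\rceil}$.
   Context: $\mathbb{N}=\{0,1,2,\ldots\}$. For $P,Q\in\mathbb{Z}$, the Lucas sequence $U_n=U_n(P,Q)$ is defined by $U_0=0$, $U_1=1$, $U_{n+2}=PU_{n+1}-QU_n$. For $R\in\mathbb{Q}$, $\mathcal{L}(P,Q,R)=\{n\in\mathbb{N} : U_nR\in\mathbb{Z}\}$. $\nu_p$ is the $p$-adic valuation ($\nu_p(0)=\infty$). $\langle m\rangle=m\mathbb{N}$. For $m\geq1$, $S_m=\{0,m,m+1,\ldots\}$. Let $U'_n=U_n(P',Q')$; $\rho'\geq 2$ denotes the rank of appearance of $p$ in $U'_n$, i.e., the least $\rho'\geq 2$ with $p\mid U'_{\rho'}$ (it exists since $p\nmid Q'$), and $\nu'=\nu_p(U'_{\rho'})$. *)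

theory Defs
  imports
    Complex_Main
    "HOL-Library.Extended_Real"
    "HOL-Computational_Algebra.Primes"
begin

fun lucas_U :: "int \<Rightarrow> int \<Rightarrow> nat \<Rightarrow> int" where
  "lucas_U P Q 0 = 0"
| "lucas_U P Q (Suc 0) = 1"
| "lucas_U P Q (Suc (Suc n)) = P * lucas_U P Q (Suc n) - Q * lucas_U P Q n"

definition lucas_int_set :: "int \<Rightarrow> int \<Rightarrow> rat \<Rightarrow> nat set" where
  "lucas_int_set P Q R = {n. of_int (lucas_U P Q n) * R \<in> \<int>}"

text \<open>The valuation takes values in \<^typ>\<open>ereal\<close>, so that the value at 0 is
  \<open>\<infinity>\<close> and differences of a finite number and a valuation are not truncated.\<close>

definition padic_val :: "nat \<Rightarrow> rat \<Rightarrow> ereal" where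
  "padic_val p x =
     (if x = 0 then \<infinity>
      else let (u, v) = quotient_of x
           in ereal (of_int (int (multiplicity (int p) u) - int (multiplicity (int p) v))))"

definition nat_multiples :: "nat \<Rightarrow> nat set" where
  "nat_multiples m = {m * k | k. True}"

definition ray_with_zero :: "nat \<Rightarrow> nat set" where
  "ray_with_zero m = insert 0 {m..}"

text \<open>The least element exists whenever \<open>p\<close> is prime and does not divide \<open>Q\<close>, which is
  the only case in which the rank is used.\<close>

definition lucas_rank :: "nat \<Rightarrow> int \<Rightarrow> int \<Rightarrow> nat" where
  "lucas_rank p P Q = (LEAST k. k \<ge> 2 \<and> int p dvd lucas_U P Q k)"

end

theory Submission
  imports Defs "HOL-Number_Theory.Cong"
begin

text \<open>Since \<open>b = 2a\<close>, scaling the roots gives \<open>U\<^sub>n = p\<^bsup>a(n-1)\<^esup> U'\<^sub>n\<close>, so everything reduces to the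
  valuation of \<open>U'\<^sub>n\<close>. It vanishes unless \<open>\<rho>'\<close> divides \<open>n\<close>, and for \<open>n = \<rho>'k\<close> one has
  \<open>U'\<^sub>n = U'\<^bsub>\<rho>'\<^esub> W\<^sub>k\<close>, where \<open>W\<close> is again a Lucas sequence, with parameters
  \<open>V = V'\<^bsub>\<rho>'\<^esub>\<close> and \<open>Q'\<^bsup>\<rho>'\<^esup>\<close> and discriminant \<open>(P'\<^sup>2 - 4Q') U'\<^bsub>\<rho>'\<^esub>\<^sup>2\<close>, divisible by \<open>p\<^sup>2\<close>. Modulo the discriminant,
  \<open>2\<^bsup>k-1\<^esup> W\<^sub>k\<close> is \<open>k V\<^bsup>k-1\<^esup>\<close>; applying this to \<open>k\<close> prime to \<open>p\<close> and to \<open>k = p\<close>, and using the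
  composition law once more for \<open>k = pj\<close>, shows that \<open>W\<^sub>k\<close> and \<open>k\<close> have the same valuation.\<close>

section \<open>Identities for Lucas sequences\<close>

text \<open>The companion Lucas sequence: the sum of the n-th powers of the roots of x^2 - P x + Q,
  expressed through \<open>lucas_U\<close>.\<close>

definition lucas_V :: "int \<Rightarrow> int \<Rightarrow> nat \<Rightarrow> int" where
  "lucas_V P Q n = 2 * lucas_U P Q (Suc n) - P * lucas_U P Q n"

text \<open>The classical U(m) U(n+1) - Q U(m-1) U(n), with -Q U(m-1) rewritten as U(m+1) - P U(m)
  so that no predecessor index occurs.\<close>

lemma lucas_U_add:
  "lucas_U P Q (m + n) = lucas_U P Q m * lucas_U P Q (Suc n) + lucas_U P Q (Suc m) * lucas_U P Q n
     - P * lucas_U P Q m * lucas_U P Q n"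
proof (induction n rule: less_induct)
  case (less n)
  consider "n = 0" | "n = 1" | k where "n = Suc (Suc k)"
    by (metis One_nat_def not0_implies_Suc)
  then show ?case
  proof cases
    case 3
    have "lucas_U P Q (m + n) = P * lucas_U P Q (m + Suc k) - Q * lucas_U P Q (m + k)"
      using 3 by simp
    also have "lucas_U P Q (m + Suc k) = lucas_U P Q m * lucas_U P Q (Suc (Suc k))
        + lucas_U P Q (Suc m) * lucas_U P Q (Suc k) - P * lucas_U P Q m * lucas_U P Q (Suc k)"
      using 3 by (intro less) simp
    also have "lucas_U P Q (m + k) = lucas_U P Q m * lucas_U P Q (Suc k)
        + lucas_U P Q (Suc m) * lucas_U P Q k - P * lucas_U P Q m * lucas_U P Q k"
      using 3 by (intro less) simp
    finally show ?thesis
      using 3 by (simp add: algebra_simps)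
  qed (simp_all add: algebra_simps)
qed

text \<open>For the roots \<alpha>, \<beta> of x^2 - P x + Q one has \<alpha>^n = U(n+1) - \<beta>
  U(n); multiplying by the conjugate equation gives the claim.\<close>

lemma lucas_U_norm:
  "(lucas_U P Q (Suc n))\<^sup>2 - P * lucas_U P Q n * lucas_U P Q (Suc n) + Q * (lucas_U P Q n)\<^sup>2 = Q ^ n"
proof (induction n)
  case (Suc n)
  have "Q ^ Suc n = Q * ((lucas_U P Q (Suc n))\<^sup>2 - P * lucas_U P Q n * lucas_U P Q (Suc n)
      + Q * (lucas_U P Q n)\<^sup>2)"
    by (simp add: Suc)
  then show ?case
    by (simp add: algebra_simps power2_eq_square)
qed simp

text \<open>Prepares a pigeonhole argument: if the pairs of consecutive terms at \<open>i\<close>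
  and \<open>i + e\<close> agree modulo p, the left side vanishes modulo p.\<close>

lemma lucas_U_d_Ocagne:
  "lucas_U P Q (Suc i) * lucas_U P Q (i + e) - lucas_U P Q i * lucas_U P Q (Suc (i + e))
     = Q ^ i * lucas_U P Q e"
proof -
  have "lucas_U P Q (Suc (i + e))
      = lucas_U P Q (Suc i) * lucas_U P Q (Suc e) - Q * lucas_U P Q i * lucas_U P Q e"
    using lucas_U_add[of P Q "Suc i" e] by (simp add: algebra_simps)
  then show ?thesis
    unfolding lucas_U_norm[of P Q i, symmetric] lucas_U_add[of P Q i e] \<open>lucas_U P Q (Suc (i + e)) = _\<close>
    by (simp add: algebra_simps power2_eq_square)
qed

text \<open>Both sides are (\<alpha>^d - \<beta>^d)^2 for the roots \<alpha>, \<beta>.\<close>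

lemma lucas_V_discriminant:
  "(lucas_V P Q d)\<^sup>2 - 4 * Q ^ d = (P\<^sup>2 - 4 * Q) * (lucas_U P Q d)\<^sup>2"
  unfolding lucas_U_norm[of P Q d, symmetric] lucas_V_def
  by (simp add: algebra_simps power2_eq_square)

text \<open>The d-th powers of the roots have sum \<open>lucas_V P Q d\<close> and product
  \<open>Q ^ d\<close>, so they govern the terms along a progression of difference
  \<open>d\<close>.\<close>

lemma lucas_U_step:
  "lucas_U P Q (n + d + d) = lucas_V P Q d * lucas_U P Q (n + d) - Q ^ d * lucas_U P Q n"
proof (induction n rule: less_induct)
  case (less n)
  consider "n = 0" | "n = 1" | k where "n = Suc (Suc k)"
    by (metis One_nat_def not0_implies_Suc)
  then show ?case
  proof cases
    case 1
    then show ?thesis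
      using lucas_U_add[of P Q d d] by (simp add: lucas_V_def algebra_simps)
  next
    case 2
    have "lucas_U P Q (Suc d + d) = (lucas_U P Q (Suc d))\<^sup>2 - Q * (lucas_U P Q d)\<^sup>2"
      using lucas_U_add[of P Q "Suc d" d] by (simp add: algebra_simps power2_eq_square)
    with 2 show ?thesis
      using lucas_U_norm[of P Q d] by (simp add: lucas_V_def algebra_simps power2_eq_square)
  next
    case 3
    have "lucas_U P Q (n + d + d) = P * lucas_U P Q (Suc k + d + d) - Q * lucas_U P Q (k + d + d)"
      using 3 by simp
    also have "lucas_U P Q (Suc k + d + d)
        = lucas_V P Q d * lucas_U P Q (Suc k + d) - Q ^ d * lucas_U P Q (Suc k)"
      using 3 by (intro less) simp
    also have "lucas_U P Q (k + d + d) = lucas_V P Q d * lucas_U P Q (k + d) - Q ^ d * lucas_U P Q k"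
      using 3 by (intro less) simp
    finally show ?thesis
      using 3 by (simp add: algebra_simps)
  qed
qed

lemma lucas_U_mult:
  "lucas_U P Q (d * k) = lucas_U P Q d * lucas_U (lucas_V P Q d) (Q ^ d) k"
proof (induction k rule: less_induct)
  case (less k)
  consider "k = 0" | "k = 1" | j where "k = Suc (Suc j)"
    by (metis One_nat_def not0_implies_Suc)
  then show ?case
  proof cases
    case 3
    have "d * k = d * j + d + d" "d * Suc j = d * j + d"
      using 3 by simp_all
    then show ?thesis
      using less[of j] less[of "Suc j"] lucas_U_step[of P Q "d * j" d] 3
      by (simp add: algebra_simps)
  qed simp_all
qed

text \<open>Multiplying both roots by \<open>c\<close> multiplies U(n) by c^(n-1); the shifted index
  avoids a truncated exponent.\<close>

lemma lucas_U_scale: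
  "lucas_U (c * P) (c\<^sup>2 * Q) (Suc n) = c ^ n * lucas_U P Q (Suc n)"
proof (induction n rule: less_induct)
  case (less n)
  consider "n = 0" | "n = 1" | k where "n = Suc (Suc k)"
    by (metis One_nat_def not0_implies_Suc)
  then show ?case
  proof cases
    case 3
    have "lucas_U (c * P) (c\<^sup>2 * Q) (Suc n)
        = c * P * lucas_U (c * P) (c\<^sup>2 * Q) (Suc (Suc k)) - c\<^sup>2 * Q * lucas_U (c * P) (c\<^sup>2 * Q) (Suc k)"
      using 3 by simp
    also have "\<dots> = c * P * (c ^ Suc k * lucas_U P Q (Suc (Suc k))) - c\<^sup>2 * Q * (c ^ k * lucas_U P Q (Suc k))"
      using less[of k] less[of "Suc k"] 3 by simp
    also have "\<dots> = c ^ n * lucas_U P Q (Suc n)"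
      using 3 by (simp add: algebra_simps power2_eq_square)
    finally show ?thesis .
  qed simp_all
qed

text \<open>Modulo the discriminant the roots merge into the double root P/2, and U(k+1) becomes
  (k+1) (P/2)^k; the power of 2 clears the denominator.\<close>

lemma discriminant_dvd_lucas_U:
  "P\<^sup>2 - 4 * Q dvd 2 ^ k * lucas_U P Q (Suc k) - int (Suc k) * P ^ k"
proof (induction k rule: less_induct)
  case (less n)
  consider "n = 0" | "n = 1" | k where "n = Suc (Suc k)"
    by (metis One_nat_def not0_implies_Suc)
  then show ?case
  proof cases
    case 3
    define A where "A = 2 ^ k * lucas_U P Q (Suc k) - int (Suc k) * P ^ k"
    define B where "B = 2 ^ Suc k * lucas_U P Q (Suc (Suc k)) - int (Suc (Suc k)) * P ^ Suc k"
    \<comment> \<open>The induction step as a polynomial identity: the new error is a combination of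
      the two previous errors plus a multiple of the discriminant.\<close>
    have "4 * t * (P * y - Q * x) - (s + 3) * (P * P * u)
        = 2 * P * (2 * t * y - (s + 2) * (P * u)) - 4 * Q * (t * x - (s + 1) * u)
          + (P * P - 4 * Q) * ((s + 1) * u)" for s t u x y :: int
      by (simp add: algebra_simps)
    from this[of "2 ^ k" "lucas_U P Q (Suc (Suc k))" "lucas_U P Q (Suc k)" "int k" "P ^ k"]
    have "2 ^ n * lucas_U P Q (Suc n) - int (Suc n) * P ^ n
        = 2 * P * B - 4 * Q * A + (P\<^sup>2 - 4 * Q) * (int (Suc k) * P ^ k)"
      unfolding A_def B_def 3 by (simp add: power2_eq_square mult.assoc add.commute)
    moreover have "P\<^sup>2 - 4 * Q dvd A" "P\<^sup>2 - 4 * Q dvd B"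
      unfolding A_def B_def by (intro less; simp add: 3)+
    ultimately show ?thesis
      by simp
  qed (simp_all add: algebra_simps)
qed

section \<open>Divisibility of Lucas numbers by a prime\<close>

text \<open>Pairs of consecutive residues modulo p must repeat; at distance e this gives p dividing
  Q^i U(e), and Q is a unit modulo p.\<close>

lemma exists_prime_dvd_lucas_U:
  assumes p: "prime p" and Q: "\<not> int p dvd Q"
  shows "\<exists>k\<ge>2. int p dvd lucas_U P Q k"
proof -
  let ?f = "\<lambda>n. (lucas_U P Q n mod int p, lucas_U P Q (Suc n) mod int p)"
  have "range ?f \<subseteq> {0..<int p} \<times> {0..<int p}"
    using prime_gt_0_nat[OF p] by auto
  then have "finite (range ?f)"
    using finite_subset by blast
  then have "\<not> inj ?f"
    using finite_imageD infinite_UNIV_nat by blast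
  then obtain i j where ij: "i < j" "?f i = ?f j"
    unfolding inj_def by (metis linorder_neqE_nat)
  define e where "e = j - i"
  then have j: "j = i + e" and e: "e > 0"
    using ij by auto
  have "[lucas_U P Q (Suc i) * lucas_U P Q (i + e) - lucas_U P Q i * lucas_U P Q (Suc (i + e)) =
      lucas_U P Q (Suc i) * lucas_U P Q i - lucas_U P Q i * lucas_U P Q (Suc i)] (mod int p)"
    using ij(2) unfolding j by (intro cong_diff cong_mult) (auto simp: cong_def)
  then have "[Q ^ i * lucas_U P Q e = 0] (mod int p)"
    by (simp add: lucas_U_d_Ocagne mult.commute)
  then have dvd: "int p dvd lucas_U P Q e"
    using p Q prime_dvd_power by (metis cong_0_iff prime_dvd_mult_iff prime_nat_int_transfer)
  have "e \<noteq> 1"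
    using dvd p by auto
  with e dvd show ?thesis
    by (intro exI[of _ e]) auto
qed

lemma lucas_rank:
  assumes "prime p" "\<not> int p dvd Q"
  shows "lucas_rank p P Q \<ge> 2" "int p dvd lucas_U P Q (lucas_rank p P Q)"
  using LeastI_ex[OF exists_prime_dvd_lucas_U[OF assms]] unfolding lucas_rank_def by auto

text \<open>With d the rank, U(k+d) is congruent to U(k) U(d+1) modulo p and U(d+1) is a unit, so
  divisibility by p has period d.\<close>

lemma prime_dvd_lucas_U_iff:
  assumes p: "prime p" and Q: "\<not> int p dvd Q"
  shows "int p dvd lucas_U P Q n \<longleftrightarrow> lucas_rank p P Q dvd n"
proof (induction n rule: less_induct)
  case (less n)
  let ?d = "lucas_rank p P Q"
  note d = lucas_rank[OF p Q, of P]
  show ?case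
  proof (cases "n < ?d")
    case True
    consider "n = 0" | "n = 1" | "n \<ge> 2"
      by linarith
    then show ?thesis
    proof cases
      case 2
      then show ?thesis
        using d(1) p by auto
    next
      case 3
      then show ?thesis
        using True not_less_Least[of n "\<lambda>k. k \<ge> 2 \<and> int p dvd lucas_U P Q k"]
        unfolding lucas_rank_def[symmetric] by (auto dest: dvd_imp_le)
    qed simp
  next
    case False
    define k where "k = n - ?d"
    have n: "n = k + ?d"
      using False k_def by simp
    \<comment> \<open>By the norm identity, a common divisor of U(d) and U(d+1) divides Q^d.\<close>
    have "\<not> int p dvd lucas_U P Q (Suc ?d)"
    proof
      assume "int p dvd lucas_U P Q (Suc ?d)"
      with d(2) have "int p dvd Q ^ ?d"
        unfolding lucas_U_norm[of P Q ?d, symmetric]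
        by (simp add: power2_eq_square)
      then show False
        using p Q prime_dvd_power by (metis prime_nat_int_transfer)
    qed
    moreover have "int p dvd lucas_U P Q n \<longleftrightarrow> int p dvd lucas_U P Q k * lucas_U P Q (Suc ?d)"
    proof -
      have "lucas_U P Q n = lucas_U P Q k * lucas_U P Q (Suc ?d)
          + lucas_U P Q ?d * (lucas_U P Q (Suc k) - P * lucas_U P Q k)"
        unfolding n lucas_U_add by (simp add: algebra_simps)
      then show ?thesis
        using d(2) by (simp add: dvd_add_left_iff)
    qed
    ultimately have "int p dvd lucas_U P Q n \<longleftrightarrow> int p dvd lucas_U P Q k"
      using p by (simp add: prime_dvd_mult_iff)
    also have "\<dots> \<longleftrightarrow> ?d dvd k"
      using less[of k] n d(1) by simp
    finally show ?thesis
      by (simp add: n)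
  qed
qed

section \<open>Valuations of Lucas numbers\<close>

text \<open>Each factor p of \<open>k\<close> is stripped by the composition law: U(p) has valuation
  exactly 1, and the cofactor is a Lucas sequence with new parameters meeting the same hypotheses.
  Hence the induction generalises \<open>P\<close> and \<open>Q\<close>.\<close>

lemma multiplicity_lucas_U_square_discriminant:
  assumes p: "prime p" "p \<ge> 3" and "\<not> int p dvd Q" "(int p)\<^sup>2 dvd P\<^sup>2 - 4 * Q" "k > 0"
  shows "lucas_U P Q k \<noteq> 0 \<and> multiplicity (int p) (lucas_U P Q k) = multiplicity p k"
  using assms(3-)
proof (induction k arbitrary: P Q rule: less_induct)
  case (less k)
  have pp: "prime (int p)"
    using p by simp
  have two: "\<not> int p dvd 2 ^ n" for n
  proof
    assume "int p dvd 2 ^ n"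
    then have "int p dvd 2"
      using pp prime_dvd_power by blast
    then show False
      using p(2) by (auto dest: zdvd_imp_le)
  qed
  \<comment> \<open>Modulo p, P^2 is 4 Q, a unit because p is odd.\<close>
  have P: "\<not> int p dvd P ^ n" for n
  proof
    assume "int p dvd P ^ n"
    then have "int p dvd P\<^sup>2"
      using pp prime_dvd_power by (metis dvd_mult power2_eq_square)
    moreover have "int p dvd P\<^sup>2 - 4 * Q"
      using less.prems(2) by (metis dvd_mult_left power2_eq_square)
    ultimately have "int p dvd 2 ^ 2 * Q"
      using dvd_diff[of "int p" "P\<^sup>2" "P\<^sup>2 - 4 * Q"] by simp
    then show False
      using two[of 2] less.prems(1) pp prime_dvd_mult_iff by blast
  qed
  have cong: "(int p)\<^sup>2 dvd 2 ^ (n - 1) * lucas_U P Q n - int n * P ^ (n - 1)" if "n > 0" for n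
    using dvd_trans[OF less.prems(2) discriminant_dvd_lucas_U[of P Q "n - 1"]] that by simp
  have congp: "int p dvd 2 ^ (n - 1) * lucas_U P Q n - int n * P ^ (n - 1)" if "n > 0" for n
    using cong[OF that] by (metis dvd_mult_left power2_eq_square)
  have iff: "int p dvd lucas_U P Q n \<longleftrightarrow> p dvd n" if "n > 0" for n
  proof -
    have "int p dvd 2 ^ (n - 1) * lucas_U P Q n \<longleftrightarrow> int p dvd int n * P ^ (n - 1)"
      using congp[OF that] by (metis dvd_diff_left_iff dvd_diff_right_iff)
    then show ?thesis
      using two P pp by (simp add: prime_dvd_mult_iff)
  qed
  show ?case
  proof (cases "p dvd k")
    case False
    then show ?thesis
      using iff[of k] less.prems(3) by (auto simp: not_dvd_imp_multiplicity_0)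
  next
    case True
    then obtain j where k: "k = p * j" by blast
    let ?V = "lucas_V P Q p" and ?W = "lucas_U (lucas_V P Q p) (Q ^ p) j"
    have p0: "p > 0" and j: "j > 0"
      using less.prems(3) k by auto
    \<comment> \<open>The congruence is taken modulo p^2 here: 2^(p-1) U(p) is p P^(p-1), which has
      only one factor p.\<close>
    have "\<not> (int p)\<^sup>2 dvd lucas_U P Q p"
    proof
      assume "(int p)\<^sup>2 dvd lucas_U P Q p"
      then have "(int p)\<^sup>2 dvd 2 ^ (p - 1) * lucas_U P Q p - (2 ^ (p - 1) * lucas_U P Q p - int p * P ^ (p - 1))"
        by (rule dvd_diff[OF dvd_mult cong[OF p0]])
      then have "int p * int p dvd int p * P ^ (p - 1)"
        by (simp add: power2_eq_square)
      then show False
        using P p0 by simp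
    qed
    moreover have "int p dvd lucas_U P Q p"
      using iff[OF p0] by simp
    ultimately have Up: "lucas_U P Q p \<noteq> 0" "multiplicity (int p) (lucas_U P Q p) = 1"
      by (auto intro!: multiplicity_eqI simp: power2_eq_square)
    have "j < k"
      using k j p(2) by simp
    moreover have "\<not> int p dvd Q ^ p"
      using less.prems(1) pp prime_dvd_power by blast
    moreover have "(int p)\<^sup>2 dvd ?V\<^sup>2 - 4 * Q ^ p"
      unfolding lucas_V_discriminant using less.prems(2) by simp
    ultimately have W: "?W \<noteq> 0" "multiplicity (int p) ?W = multiplicity p j"
      using less.IH j by blast+
    have "multiplicity (int p) (lucas_U P Q k) = 1 + multiplicity p j"
      unfolding k lucas_U_mult using Up W pp by (simp add: prime_elem_multiplicity_mult_distrib)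
    moreover have "multiplicity p k = 1 + multiplicity p j"
      unfolding k using p0 j p by (simp add: prime_elem_multiplicity_mult_distrib)
    ultimately show ?thesis
      using Up W by (simp add: k lucas_U_mult)
  qed
qed

text \<open>The cofactor of U(\<rho>) has discriminant divisible by U(\<rho>)^2, hence by p^2, so
  the preceding lemma applies to it. Vanishing of U(\<rho>) is treated apart, as
  \<open>multiplicity\<close> is 0 at 0.\<close>

lemma multiplicity_lucas_U_rank_mult:
  fixes P Q :: int
  defines "U \<equiv> lucas_U P Q"
  assumes p: "prime p" "p \<ge> 3" and Q: "\<not> int p dvd Q" and \<rho>: "\<rho> = lucas_rank p P Q" and k: "k > 0"
  shows "U (\<rho> * k) = 0 \<longleftrightarrow> U \<rho> = 0"
    and "U \<rho> \<noteq> 0 \<Longrightarrow> multiplicity (int p) (U (\<rho> * k)) = multiplicity (int p) (U \<rho>) + multiplicity p k"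
proof -
  let ?V = "lucas_V P Q \<rho>" and ?W = "lucas_U (lucas_V P Q \<rho>) (Q ^ \<rho>) k"
  have "\<not> int p dvd Q ^ \<rho>"
    using Q p prime_dvd_power by (metis prime_nat_int_transfer)
  moreover have "(int p)\<^sup>2 dvd ?V\<^sup>2 - 4 * Q ^ \<rho>"
    unfolding lucas_V_discriminant \<rho> using lucas_rank(2)[OF p(1) Q] by (simp add: dvd_power_same)
  ultimately have W: "?W \<noteq> 0" "multiplicity (int p) ?W = multiplicity p k"
    using multiplicity_lucas_U_square_discriminant[OF p] k by blast+
  show "U (\<rho> * k) = 0 \<longleftrightarrow> U \<rho> = 0"
    using W by (simp add: U_def lucas_U_mult)
  show "multiplicity (int p) (U (\<rho> * k)) = multiplicity (int p) (U \<rho>) + multiplicity p k" if "U \<rho> \<noteq> 0"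
    using W that p unfolding U_def lucas_U_mult by (simp add: prime_elem_multiplicity_mult_distrib)
qed

section \<open>From integrality to valuations\<close>

lemma padic_val_of_int:
  "padic_val p (of_int x) = (if x = 0 then \<infinity> else ereal (real (multiplicity (int p) x)))"
  by (simp add: padic_val_def)

lemma multiplicity_int_int: "multiplicity (int p) (int k) = multiplicity p k"
  by (simp add: multiplicity_def flip: of_nat_power)

lemma padic_val_of_nat:
  "padic_val p (of_nat k) = (if k = 0 then \<infinity> else ereal (real (multiplicity p k)))"
  using padic_val_of_int[of p "int k"] by (simp add: multiplicity_int_int)

lemma of_int_times_prime_powi_in_Ints_iff:
  assumes "p > 0"
  shows "of_int x * (of_nat p :: rat) powi (- int r) \<in> \<int> \<longleftrightarrow> int p ^ r dvd x"
proof -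
  have "of_int x * (of_nat p :: rat) powi (- int r) = of_int x / of_int (int p ^ r)"
    by (simp add: power_int_minus divide_inverse)
  also have "\<dots> \<in> \<int> \<longleftrightarrow> int p ^ r dvd x"
  proof
    assume "(of_int x / of_int (int p ^ r) :: rat) \<in> \<int>"
    then obtain y where "(of_int x / of_int (int p ^ r) :: rat) = of_int y"
      by (elim Ints_cases)
    then have "(of_int x :: rat) = of_int (int p ^ r * y)"
      using assms by (simp add: field_simps)
    then show "int p ^ r dvd x"
      by (simp only: of_int_eq_iff dvd_triv_left)
  qed (rule of_int_divide_in_Ints)
  finally show ?thesis .
qed

text \<open>The scaling law supplies the factor p^(a(n-1)); since n is positive, the natural
  subtraction is exact.\<close>

lemma mem_lucas_int_set_iff:
  assumes p: "prime p" "p \<ge> 3" and Q: "\<not> int p dvd Q" and n: "n > 0"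
  shows "n \<in> lucas_int_set (int p ^ a * P) ((int p ^ a)\<^sup>2 * Q) (of_nat p powi (- int r)) \<longleftrightarrow>
    lucas_U P Q n = 0 \<or> r \<le> a * (n - 1) + multiplicity (int p) (lucas_U P Q n)"
proof -
  have pp: "prime (int p)" and p0: "p > 0"
    using p by auto
  obtain k where k: "n = Suc k"
    using n gr0_conv_Suc by blast
  let ?U = "lucas_U P Q n"
  have "n \<in> lucas_int_set (int p ^ a * P) ((int p ^ a)\<^sup>2 * Q) (of_nat p powi (- int r)) \<longleftrightarrow>
      int p ^ r dvd int p ^ (a * (n - 1)) * ?U"
    unfolding lucas_int_set_def k
    using p0 by (simp add: of_int_times_prime_powi_in_Ints_iff lucas_U_scale power_mult del: lucas_U.simps)
  also have "\<dots> \<longleftrightarrow> ?U = 0 \<or> r \<le> a * (n - 1) + multiplicity (int p) ?U"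
  proof (cases "?U = 0")
    case False
    then have "int p ^ r dvd int p ^ (a * (n - 1)) * ?U
        \<longleftrightarrow> r \<le> multiplicity (int p) (int p ^ (a * (n - 1)) * ?U)"
      using pp p0 by (intro power_dvd_iff_le_multiplicity) auto
    also have "multiplicity (int p) (int p ^ (a * (n - 1)) * ?U)
        = a * (n - 1) + multiplicity (int p) ?U"
      using False pp p0 by (simp add: prime_elem_multiplicity_mult_distrib)
    finally show ?thesis
      using False by simp
  qed simp
  finally show ?thesis .
qed

theorem theorem5p3:
  fixes P Q P' Q' :: int and p a b r \<rho>' m :: nat and \<nu>' :: ereal
  assumes "P * Q \<noteq> 0"
    and "prime p" and "p \<ge> 3"
    and "int p dvd P" and "int p dvd Q"
    and "P = int p ^ a * P'" and "Q = int p ^ b * Q'"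
    and "a \<ge> 1" and "b \<ge> 1"
    and "\<not> int p dvd P' * Q'"
    and "b = 2 * a"
    and "r \<ge> 1"
    and rho: "\<rho>' = lucas_rank p P' Q'"
    and nu: "\<nu>' = padic_val p (of_int (lucas_U P' Q' \<rho>'))"
    and m: "m = nat \<lceil>(of_nat r + of_nat a) / (of_nat a :: rat)\<rceil>"
  shows "lucas_int_set P Q (of_nat p powi (- int r)) =
           ray_with_zero m \<union>
           {n \<in> nat_multiples \<rho>'.
              padic_val p (of_nat n / of_nat \<rho>')
                \<ge> ereal (real r + real a - real a * real n) - \<nu>'}
       \<and> (\<rho>' \<ge> m \<longrightarrow>
            lucas_int_set P Q (of_nat p powi (- int r)) = ray_with_zero m)"
proof -
  let ?L = "lucas_int_set P Q (of_nat p powi (- int r))"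
  let ?R = "{n \<in> nat_multiples \<rho>'. padic_val p (of_nat n / of_nat \<rho>')
                \<ge> ereal (real r + real a - real a * real n) - \<nu>'}"
  have p: "prime p" "p \<ge> 3" and Q': "\<not> int p dvd Q'" and a: "a > 0"
    using assms by auto
  have PQ: "P = int p ^ a * P'" "Q = (int p ^ a)\<^sup>2 * Q'"
    using assms by (auto simp: power_mult[symmetric] mult.commute)
  have \<rho>2: "\<rho>' \<ge> 2"
    using lucas_rank(1)[OF p(1) Q'] rho by simp
  note mem = mem_lucas_int_set_iff[OF p Q', of _ a P' r, folded PQ]
  \<comment> \<open>For positive n the ray is thus where the factor p^(a(n-1)) alone cancels
    p^r.\<close>
  have m_iff: "m \<le> n \<longleftrightarrow> r + a \<le> a * n" for n
  proof -
    have "m \<le> n \<longleftrightarrow> (of_nat r + of_nat a) / (of_nat a :: rat) \<le> of_nat n"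
      unfolding m by (simp add: nat_le_iff ceiling_le_iff)
    also have "\<dots> \<longleftrightarrow> (of_nat (r + a) :: rat) \<le> of_nat (a * n)"
      using a by (simp add: field_simps)
    finally show ?thesis
      by (simp only: of_nat_le_iff)
  qed
  have "n \<in> ?L \<longleftrightarrow> n \<in> ray_with_zero m \<union> ?R" for n
  proof (cases "n = 0")
    case True
    then show ?thesis
      by (simp add: lucas_int_set_def ray_with_zero_def)
  next
    case n0: False
    have an: "a * (n - 1) + a = a * n"
      using n0 by (cases n) auto
    show ?thesis
    proof (cases "\<rho>' dvd n")
      case False
      then have "\<not> int p dvd lucas_U P' Q' n"
        using prime_dvd_lucas_U_iff[OF p(1) Q'] rho by simp
      then have "n \<in> ?L \<longleftrightarrow> m \<le> n"
        using mem[of n] n0 an m_iff[of n] by (auto simp: not_dvd_imp_multiplicity_0)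
      moreover have "n \<notin> ?R"
        using False by (auto simp: nat_multiples_def)
      ultimately show ?thesis
        using n0 by (auto simp: ray_with_zero_def)
    next
      case True
      then obtain k where k: "n = \<rho>' * k" by blast
      have k0: "k > 0"
        using n0 k by simp
      note U = multiplicity_lucas_U_rank_mult[OF p Q' rho k0, folded k]
      have "(of_nat n / of_nat \<rho>' :: rat) = of_nat k"
        using \<rho>2 k by simp
      then have "n \<in> ?R \<longleftrightarrow>
          ereal (real r + real a - real a * real n) - \<nu>' \<le> ereal (real (multiplicity p k))"
        using k k0 by (auto simp: nat_multiples_def padic_val_of_nat)
      also have "\<dots> \<longleftrightarrow> lucas_U P' Q' n = 0 \<or>
          r \<le> a * (n - 1) + multiplicity (int p) (lucas_U P' Q' n)"
      proof (cases "lucas_U P' Q' \<rho>' = 0")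
        \<comment> \<open>Here \<nu>' is infinite, so the bound is minus infinity, and U' vanishes
          at every multiple of \<rho>'.\<close>
        case True
        then show ?thesis
          using U(1) by (simp add: nu padic_val_def)
      next
        case False
        let ?\<mu> = "multiplicity (int p) (lucas_U P' Q' \<rho>')"
        have "ereal (real r + real a - real a * real n) - \<nu>' \<le> ereal (real (multiplicity p k))
            \<longleftrightarrow> real (r + a) \<le> real (a * n + ?\<mu> + multiplicity p k)"
          using False unfolding nu padic_val_of_int by auto
        also have "\<dots> \<longleftrightarrow> r + a \<le> a * n + ?\<mu> + multiplicity p k"
          by (rule of_nat_le_iff)
        finally show ?thesis
          using False U an by auto
      qed
      also have "\<dots> \<longleftrightarrow> n \<in> ?L"
        using mem[of n] n0 by simp
      finally have "n \<in> ?L \<longleftrightarrow> n \<in> ?R" by simp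
      \<comment> \<open>The two sets of the union may overlap; in the ray the prime power already
        forces membership.\<close>
      moreover have "n \<in> ?L" if "m \<le> n"
        using that mem[of n] n0 an m_iff[of n] by auto
      ultimately show ?thesis
        using n0 by (auto simp: ray_with_zero_def)
    qed
  qed
  then have L: "?L = ray_with_zero m \<union> ?R"
    by blast
  \<comment> \<open>A positive multiple of \<rho>' is at least \<rho>', hence in the ray; the
    multiple 0 is the adjoined point.\<close>
  moreover have "?R \<subseteq> ray_with_zero m" if "m \<le> \<rho>'"
  proof
    fix n assume "n \<in> ?R"
    then obtain k where "n = \<rho>' * k"
      by (auto simp: nat_multiples_def)
    then show "n \<in> ray_with_zero m"
      using that by (cases k) (auto simp: ray_with_zero_def)
  qed
  ultimately show ?thesis
    by blast
qed

end
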